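(* Under the setting in the context, let $b\in\mathbb{R}^M$ be a least squares solution of the overdetermined system $Pb=c$. Then the residual $r=Pb-c$ satisfies \[|r|^2\le m\,C\sum_{\ell=1}^M h_\ell^2\,\mathcal{E}(h_\ell)^2\,\|\mathbf{u}\|^2_{\mathcal{N}(\Omega_\ell)},\] where $C$ is a constant independent of the $h_\ell$ and of $\mathbf{u}$.
   Context: Setting: $\Omega$ is a bounded open subset of $\mathcal{P}$, $\mathcal{P}=\mathbb{R}^2$ or a smooth orientable surface in $\mathbb{R}^3$ ($d=2$), with unit normal $\mathbf{n}$ ($\mathbf{n}=(0,0,1)$ for $\mathbb{R}^2$); $Q_{\mathbf{x}}\mathbf{v}=\mathbf{n}(\mathbf{x})\times\mathbf{v}$, surface curl $\mathbf{L}=Q_{\mathbf{x}}\nabla$. The div-free kernel is $\Phi_{\rm div}(\mathbf{x},\mathbf{y})=Q_{\mathbf{x}}(\nabla\nabla^T\phi(\|\mathbf{x}-\mathbf{y}\|))Q_{\mathbf{y}}$ for a positive definite radial $\phi$, with native space $\mathcal{N}(\cdot)$ continuously embedded in $\mathbf{H}^\tau(\Omega)$, $\tau>1$; $\mathbf{u}\in\mathcal{N}(\Omega)$ is a tangential div-free field. Patches $\Omega_1,\dots,\Omega_M\subset\Omega$ form an open cover of $\Omega$, each satisfying an interior cone condition with radius $R_\ell$ and angle $\theta$ independent of $\ell$; each patch intersects at most $m$ patches; $X_\ell=X\cap\Omega_\ell$ has mesh norm $h_\ell=\sup_{\mathbf{y}\in\Omega_\ell}\min_{\mathbf{x}\in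 X_\ell}\operatorname{dist}(\mathbf{x},\mathbf{y})$ with $h_\ell<QR_\ell$; $c\,h_\ell\le\operatorname{diam}(\Omega_\ell)\le Ch_\ell$ with $c,C$ independent of $\ell$, and $h_k$ and $h_\ell$ are comparable (uniformly) for overlapping patches. The local div-free interpolant $\mathbf{s}_\ell(\mathbf{x})=\sum_j\Phi_{\rm div}(\mathbf{x},\mathbf{x}_j)\mathbf{c}_j$ ($\mathbf{c}_j$ tangent at $\mathbf{x}_j\in X_\ell$, $\mathbf{s}_\ell=\mathbf{u}$ on $X_\ell$) has potential $\psi_\ell(\mathbf{x})=\sum_j\nabla^T\phi(\|\mathbf{x}-\mathbf{x}_j\|)Q_{\mathbf{x}_j}\mathbf{c}_j$, so $\mathbf{s}_\ell=\mathbf{L}(\psi_\ell)$. Local estimate (assumed): there are constants $Q=Q(\theta,\tau)$, $C$ with $\|\mathbf{u}-\mathbf{s}_\ell\|_{L_\infty(\Omega_\ell)}\le\mathcal{E}(h_\ell)\|\mathbf{u}\|_{\mathcal{N}(\Omega_\ell)}$ whenever $h_\ell<QR_\ell$, where $\mathcal{E}(h)=Ch^{\tau-d/2}$. Glue points: for each pair $\ell<k$ with $\Omega_\ell\cap\Omega_k\ne\emptyset$ a point $\bar{\mathbf{x}}_\ell^k\in\Omega_\ell\cap\Omega_k$ (the center of the overlap region); enumerate these as $\bar{\mathbf{x}}_1,\dots,\bar{\mathbf{x}}_L$. The system $Pb=c$: $P$ is the $L\times M$ matrix whose $i$-th row, for $\bar{\mathbf{x}}_i=\bar{\mathbf{x}}_\ell^k$,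 has $1$ in column $\ell$, $-1$ in column $k$ and zeros elsewhere, and $c_i=\psi_k(\bar{\mathbf{x}}_i)-\psi_\ell(\bar{\mathbf{x}}_i)$; $|\cdot|$ is the Euclidean norm. *)

theory Defs
  imports "HOL-Analysis.Analysis" "HOL-Analysis.Cross3"
begin

unbundle no cross3_syntax

type_synonym pt = "real^3"

text \<open>The planar case R^2 is
  P = {x. x$3 = 0} with constant normal (0,0,1).\<close>
definition smooth_oriented_surface :: "pt set \<Rightarrow> (pt \<Rightarrow> pt) \<Rightarrow> bool" where
  "smooth_oriented_surface P n \<longleftrightarrow>
     continuous_on P n \<and> (\<forall>x\<in>P. norm (n x) = 1) \<and>
     (\<forall>x\<in>P. \<exists>U F G. open U \<and> x \<in> U \<and> continuous_on U G \<and>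
        (\<forall>y\<in>U. (F has_derivative (\<lambda>v. G y \<bullet> v)) (at y) \<and> G y \<noteq> 0) \<and>
        P \<inter> U = {y\<in>U. F y = 0} \<and>
        (\<forall>y\<in>P \<inter> U. n y = G y /\<^sub>R norm (G y)))"

definition tangential_gradient :: "pt set \<Rightarrow> (pt \<Rightarrow> pt) \<Rightarrow> (pt \<Rightarrow> real) \<Rightarrow> (pt \<Rightarrow> pt) \<Rightarrow> bool" where
  "tangential_gradient S n f g \<longleftrightarrow>
     (\<forall>x\<in>S. g x \<bullet> n x = 0 \<and> (f has_derivative (\<lambda>v. g x \<bullet> v)) (at x within S))"

definition surface_curl_of :: "pt set \<Rightarrow> (pt \<Rightarrow> pt) \<Rightarrow> (pt \<Rightarrow> real) \<Rightarrow> (pt \<Rightarrow> pt) \<Rightarrow> bool" where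
  "surface_curl_of S n f U \<longleftrightarrow>
     (\<exists>g. tangential_gradient S n f g \<and> (\<forall>x\<in>S. U x = cross3 (n x) (g x)))"

definition path_len :: "(real \<Rightarrow> pt) \<Rightarrow> real" where
  "path_len \<gamma> = integral {0..1} (\<lambda>t. norm (vector_derivative \<gamma> (at t)))"

definition C1_path_in :: "pt set \<Rightarrow> (real \<Rightarrow> pt) \<Rightarrow> pt \<Rightarrow> pt \<Rightarrow> bool" where
  "C1_path_in S \<gamma> x y \<longleftrightarrow> \<gamma> C1_differentiable_on {0..1} \<and> \<gamma> ` {0..1} \<subseteq> S \<and> \<gamma> 0 = x \<and> \<gamma> 1 = y"

definition intrinsic_dist :: "pt set \<Rightarrow> pt \<Rightarrow> pt \<Rightarrow> ereal" where
  "intrinsic_dist S x y = Inf {ereal (path_len \<gamma>) | \<gamma>. C1_path_in S \<gamma> x y}"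

definition intrinsic_diam :: "pt set \<Rightarrow> ereal" where
  "intrinsic_diam S = Sup {intrinsic_dist S x y | x y. x \<in> S \<and> y \<in> S}"

definition mesh_norm :: "pt set \<Rightarrow> pt set \<Rightarrow> real" where
  "mesh_norm X S = (SUP y\<in>S. infdist y (X \<inter> S))"

text \<open>Error function E(h) = C h^(tau - d/2), d = 2.\<close>
definition Err :: "real \<Rightarrow> real \<Rightarrow> real \<Rightarrow> real" where
  "Err CE \<tau> h = CE * h powr (\<tau> - 1)"

text \<open>Rows of P: pairs (l,k), l<k<M, of overlapping patches (patches indexed 0..M-1).\<close>
definition glue_pairs :: "nat \<Rightarrow> (nat \<Rightarrow> pt set) \<Rightarrow> (nat \<times> nat) set" where
  "glue_pairs M \<Omega>s = {(l,k). l < k \<and> k < M \<and> \<Omega>s l \<inter> \<Omega>s k \<noteq> {}}"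

text \<open>|P b - c|^2, with (Pb)_i = b_l - b_k and c_i = psi_k(xbar_i) - psi_l(xbar_i).\<close>
definition residual_sq :: "nat \<Rightarrow> (nat \<Rightarrow> pt set) \<Rightarrow> (nat \<Rightarrow> nat \<Rightarrow> pt) \<Rightarrow> (nat \<Rightarrow> pt \<Rightarrow> real)
    \<Rightarrow> (nat \<Rightarrow> real) \<Rightarrow> real" where
  "residual_sq M \<Omega>s xbar \<psi>s b =
     (\<Sum>(l,k)\<in>glue_pairs M \<Omega>s. (b l - b k - (\<psi>s k (xbar l k) - \<psi>s l (xbar l k)))\<^sup>2)"

definition least_squares_solution :: "nat \<Rightarrow> (nat \<Rightarrow> pt set) \<Rightarrow> (nat \<Rightarrow> nat \<Rightarrow> pt) \<Rightarrow> (nat \<Rightarrow> pt \<Rightarrow> real)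
    \<Rightarrow> (nat \<Rightarrow> real) \<Rightarrow> bool" where
  "least_squares_solution M \<Omega>s xbar \<psi>s b \<longleftrightarrow>
     (\<forall>b'. residual_sq M \<Omega>s xbar \<psi>s b \<le> residual_sq M \<Omega>s xbar \<psi>s b')"

end

theory Submission
  imports Defs
begin

(* The difference psi - psi_l between the global potential and a local one has a tangential
   gradient of the same length as u - s_l (the surface curl rotates the gradient by 90 degrees
   in the tangent plane), so on Omega_l it oscillates by at most diam Omega_l * E(h_l) * |u|.
   Hence the offsets b_l = (psi - psi_l)(z_l), for any z_l in Omega_l, solve P b = c up to a
   residual controlled by these oscillations, and a least squares solution does no worse.
   Each patch occurs in at most m glue pairs, which produces the factor m. *)

lemma has_vector_derivative_comp_inner_gradient:
  fixes \<gamma> :: "real \<Rightarrow> 'a::real_inner" and f :: "'a \<Rightarrow> real"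
  assumes "(\<gamma> has_vector_derivative D) (at t within T)"
    and "(f has_derivative (\<lambda>v. G \<bullet> v)) (at (\<gamma> t) within \<gamma> ` T)"
  shows "((f \<circ> \<gamma>) has_vector_derivative (G \<bullet> D)) (at t within T)"
  using diff_chain_within[OF assms[unfolded has_vector_derivative_def]]
  unfolding has_vector_derivative_def by (simp add: o_def inner_scaleR_right mult.commute)

lemma C1_path_in_Lipschitz_bound:
  fixes f :: "pt \<Rightarrow> real" and g :: "pt \<Rightarrow> pt"
  assumes der: "\<And>x. x \<in> S \<Longrightarrow> (f has_derivative (\<lambda>v. g x \<bullet> v)) (at x within S)"
    and gb: "\<And>x. x \<in> S \<Longrightarrow> norm (g x) \<le> L"
    and \<gamma>: "C1_path_in S \<gamma> x y"
  shows "\<bar>f y - f x\<bar> \<le> L * path_len \<gamma>"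
proof -
  from \<gamma> obtain D where D: "\<And>t. t \<in> {0..1} \<Longrightarrow> (\<gamma> has_vector_derivative D t) (at t)"
    and D_cont: "continuous_on {0..1} D" and im: "\<gamma> ` {0..1} \<subseteq> S" and ends: "\<gamma> 0 = x" "\<gamma> 1 = y"
    unfolding C1_path_in_def C1_differentiable_on_def by blast
  have "((f \<circ> \<gamma>) has_vector_derivative (g (\<gamma> t) \<bullet> D t)) (at t within {0..1})"
    if t: "t \<in> {0..1}" for t
  proof (rule has_vector_derivative_comp_inner_gradient)
    show "(\<gamma> has_vector_derivative D t) (at t within {0..1})"
      using D[OF t] by (rule has_vector_derivative_at_within)
    show "(f has_derivative (\<lambda>v. g (\<gamma> t) \<bullet> v)) (at (\<gamma> t) within \<gamma> ` {0..1})"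
      using der[of "\<gamma> t"] im t has_derivative_subset by blast
  qed
  then have FTC: "((\<lambda>t. g (\<gamma> t) \<bullet> D t) has_integral (f y - f x)) {0..1}"
    using fundamental_theorem_of_calculus[of 0 1 "f \<circ> \<gamma>"] ends by simp
  have "norm (integral {0..1} (\<lambda>t. g (\<gamma> t) \<bullet> D t)) \<le> integral {0..1} (\<lambda>t. L * norm (D t))"
  proof (rule integral_norm_bound_integral)
    show "(\<lambda>t. g (\<gamma> t) \<bullet> D t) integrable_on {0..1}" using FTC by blast
    show "(\<lambda>t. L * norm (D t)) integrable_on {0..1}"
      by (intro integrable_continuous_interval continuous_intros D_cont)
    fix t :: real assume t: "t \<in> {0..1}"
    have "\<bar>g (\<gamma> t) \<bullet> D t\<bar> \<le> norm (g (\<gamma> t)) * norm (D t)" by (rule Cauchy_Schwarz_ineq2)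
    also have "\<dots> \<le> L * norm (D t)" using gb im t by (intro mult_right_mono) (auto simp: image_subset_iff)
    finally show "norm (g (\<gamma> t) \<bullet> D t) \<le> L * norm (D t)" by simp
  qed
  also have "integral {0..1} (\<lambda>t. L * norm (D t)) = L * path_len \<gamma>"
    unfolding path_len_def integral_mult_right[symmetric]
    by (intro integral_cong) (metis D vector_derivative_at)
  finally show ?thesis using FTC by (simp add: integral_unique)
qed

lemma intrinsic_diam_Lipschitz_bound:
  fixes f :: "pt \<Rightarrow> real" and g :: "pt \<Rightarrow> pt"
  assumes der: "\<And>x. x \<in> S \<Longrightarrow> (f has_derivative (\<lambda>v. g x \<bullet> v)) (at x within S)"
    and gb: "\<And>x. x \<in> S \<Longrightarrow> norm (g x) \<le> L"
    and L: "L \<ge> 0" and xy: "x \<in> S" "y \<in> S" and diam: "intrinsic_diam S \<le> ereal D"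
  shows "\<bar>f y - f x\<bar> \<le> L * D"
proof -
  have "intrinsic_dist S x y \<le> intrinsic_diam S"
    unfolding intrinsic_diam_def by (rule Sup_upper) (use xy in blast)
  with diam have dist_le: "intrinsic_dist S x y \<le> ereal D" by order
  have approx: "\<bar>f y - f x\<bar> \<le> L * (D + e)" if e: "e > 0" for e
  proof -
    have "Inf {ereal (path_len \<gamma>) | \<gamma>. C1_path_in S \<gamma> x y} < ereal (D + e)"
      using dist_le e unfolding intrinsic_dist_def by (simp add: order_le_less_trans)
    then obtain \<gamma> where \<gamma>: "C1_path_in S \<gamma> x y" and short: "path_len \<gamma> < D + e"
      by (auto simp: Inf_less_iff)
    have "\<bar>f y - f x\<bar> \<le> L * path_len \<gamma>" by (rule C1_path_in_Lipschitz_bound[OF der gb \<gamma>])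
    also have "\<dots> \<le> L * (D + e)" using short L by (intro mult_left_mono) auto
    finally show ?thesis .
  qed
  show ?thesis
  proof (rule field_le_epsilon)
    fix e :: real assume e: "e > 0"
    have "\<bar>f y - f x\<bar> \<le> L * (D + e / (L + 1))" using approx[of "e / (L + 1)"] e L by simp
    also have "\<dots> \<le> L * D + e" using e L by (simp add: field_simps)
    finally show "\<bar>f y - f x\<bar> \<le> L * D + e" .
  qed
qed

lemma surface_curl_of_subset:
  "surface_curl_of S n f U \<Longrightarrow> T \<subseteq> S \<Longrightarrow> surface_curl_of T n f U"
  unfolding surface_curl_of_def tangential_gradient_def
  by (meson has_derivative_subset subsetD)

lemma norm_cross3_orthogonal:
  fixes a w :: pt
  assumes "norm a = 1" "a \<bullet> w = 0"
  shows "norm (cross3 a w) = norm w"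
proof -
  have "(norm (cross3 a w))\<^sup>2 = (norm w)\<^sup>2" using norm_cross_dot[of a w] assms by simp
  then show ?thesis by (simp add: power2_eq_iff_nonneg)
qed

lemma surface_curl_potential_oscillation:
  assumes curl_f: "surface_curl_of S n f U" and curl_g: "surface_curl_of S n g V"
    and unit: "\<And>x. x \<in> S \<Longrightarrow> norm (n x) = 1"
    and close: "\<And>x. x \<in> S \<Longrightarrow> norm (U x - V x) \<le> K"
    and diam: "intrinsic_diam S \<le> ereal D" and xy: "x \<in> S" "y \<in> S"
  shows "\<bar>(f y - g y) - (f x - g x)\<bar> \<le> K * D"
proof -
  obtain Gf Gg where Gf: "tangential_gradient S n f Gf" "\<forall>x\<in>S. U x = cross3 (n x) (Gf x)"
    and Gg: "tangential_gradient S n g Gg" "\<forall>x\<in>S. V x = cross3 (n x) (Gg x)"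
    using curl_f curl_g unfolding surface_curl_of_def by blast
  have der: "((\<lambda>x. f x - g x) has_derivative (\<lambda>v. (Gf x - Gg x) \<bullet> v)) (at x within S)"
    if "x \<in> S" for x
    using has_derivative_diff Gf(1) Gg(1) that
    unfolding tangential_gradient_def by (fastforce simp: inner_diff_left)
  have "norm (Gf x - Gg x) = norm (U x - V x)" if x: "x \<in> S" for x
  proof -
    have "n x \<bullet> (Gf x - Gg x) = 0"
      using Gf(1) Gg(1) x unfolding tangential_gradient_def by (simp add: inner_diff_right inner_commute)
    moreover have "U x - V x = cross3 (n x) (Gf x - Gg x)"
      using Gf(2) Gg(2) x by (simp add: Cross3.right_diff_distrib)
    ultimately show ?thesis using norm_cross3_orthogonal unit x by simp
  qed
  then have grad_le: "norm (Gf x - Gg x) \<le> K" if "x \<in> S" for x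
    using close that by simp
  have "K \<ge> 0" using grad_le[OF xy(1)] norm_ge_zero order_trans by blast
  from intrinsic_diam_Lipschitz_bound[OF der grad_le this xy diam] show ?thesis by simp
qed

lemma sum_glue_pairs_le:
  fixes w :: "nat \<Rightarrow> real"
  assumes w: "\<forall>l<M. w l \<ge> 0"
    and degree: "\<forall>l<M. card {k. k < M \<and> k \<noteq> l \<and> \<Omega>s l \<inter> \<Omega>s k \<noteq> {}} \<le> m"
  shows "(\<Sum>(l,k)\<in>glue_pairs M \<Omega>s. w l + w k) \<le> 2 * real m * (\<Sum>l<M. w l)"
proof -
  define N where "N l = {k. k < M \<and> k \<noteq> l \<and> \<Omega>s l \<inter> \<Omega>s k \<noteq> {}}" for l
  define Adj where "Adj = (SIGMA l:{..<M}. N l)"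
  let ?G = "glue_pairs M \<Omega>s"
  have finN: "finite (N l)" for l unfolding N_def by auto
  have finAdj: "finite Adj" unfolding Adj_def using finN by auto
  have Adj_nonneg: "\<forall>p\<in>Adj. w (fst p) \<ge> 0" unfolding Adj_def using w by auto
  have "(\<Sum>p\<in>Adj. w (fst p)) = (\<Sum>l<M. \<Sum>k\<in>N l. w l)"
    unfolding Adj_def by (subst sum.Sigma) (auto simp: finN split_def)
  also have "\<dots> = (\<Sum>l<M. real (card (N l)) * w l)" by simp
  also have "\<dots> \<le> (\<Sum>l<M. real m * w l)"
    by (intro sum_mono mult_right_mono) (use w degree in \<open>auto simp: N_def\<close>)
  finally have Adj_le: "(\<Sum>p\<in>Adj. w (fst p)) \<le> real m * (\<Sum>l<M. w l)"
    by (simp add: sum_distrib_left)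
  have G_Adj: "?G \<subseteq> Adj" "prod.swap ` ?G \<subseteq> Adj"
    unfolding Adj_def N_def glue_pairs_def by auto
  have first: "(\<Sum>p\<in>?G. w (fst p)) \<le> (\<Sum>p\<in>Adj. w (fst p))"
    by (rule sum_mono2[OF finAdj G_Adj(1)]) (use Adj_nonneg in auto)
  have "(\<Sum>p\<in>?G. w (snd p)) = (\<Sum>p\<in>prod.swap ` ?G. w (fst p))"
    by (subst sum.reindex) auto
  also have "\<dots> \<le> (\<Sum>p\<in>Adj. w (fst p))"
    by (rule sum_mono2[OF finAdj G_Adj(2)]) (use Adj_nonneg in auto)
  finally have second: "(\<Sum>p\<in>?G. w (snd p)) \<le> (\<Sum>p\<in>Adj. w (fst p))" .
  have "(\<Sum>(l,k)\<in>?G. w l + w k) = (\<Sum>p\<in>?G. w (fst p)) + (\<Sum>p\<in>?G. w (snd p))"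
    by (simp add: case_prod_beta sum.distrib)
  with first second Adj_le show ?thesis by linarith
qed

lemma square_diff_le_of_abs_le:
  fixes a c A C :: real
  assumes "\<bar>a\<bar> \<le> A" "\<bar>c\<bar> \<le> C"
  shows "(a - c)\<^sup>2 \<le> 2 * A\<^sup>2 + 2 * C\<^sup>2"
proof -
  have "(a - c)\<^sup>2 \<le> 2 * a\<^sup>2 + 2 * c\<^sup>2"
    using zero_le_power2[of "a + c"] by (simp add: power2_eq_square algebra_simps)
  moreover have "a\<^sup>2 \<le> A\<^sup>2" "c\<^sup>2 \<le> C\<^sup>2"
    using assms by (metis abs_ge_zero power2_abs power_mono)+
  ultimately show ?thesis by linarith
qed

lemma residual_sq_potential_offsets_le:
  assumes xbar: "\<forall>(l,k)\<in>glue_pairs M \<Omega>s. xbar l k \<in> \<Omega>s l \<inter> \<Omega>s k"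
    and z: "\<forall>l<M. z l \<in> \<Omega>s l"
    and osc: "\<And>l x y. l < M \<Longrightarrow> x \<in> \<Omega>s l \<Longrightarrow> y \<in> \<Omega>s l \<Longrightarrow>
      \<bar>(\<psi> y - \<psi>s l y) - (\<psi> x - \<psi>s l x)\<bar> \<le> B l"
    and degree: "\<forall>l<M. card {k. k < M \<and> k \<noteq> l \<and> \<Omega>s l \<inter> \<Omega>s k \<noteq> {}} \<le> m"
  shows "residual_sq M \<Omega>s xbar \<psi>s (\<lambda>l. \<psi> (z l) - \<psi>s l (z l))
    \<le> 4 * real m * (\<Sum>l<M. (B l)\<^sup>2)"
proof -
  let ?G = "glue_pairs M \<Omega>s"
  have pair_le: "(\<psi> (z l) - \<psi>s l (z l) - (\<psi> (z k) - \<psi>s k (z k)) - (\<psi>s k (xbar l k) - \<psi>s l (xbar l k)))\<^sup>2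
      \<le> 2 * ((B l)\<^sup>2 + (B k)\<^sup>2)" if lk: "(l,k) \<in> ?G" for l k
  proof -
    have "l < M" "k < M" "xbar l k \<in> \<Omega>s l" "xbar l k \<in> \<Omega>s k"
      using lk xbar unfolding glue_pairs_def by auto
    then have "\<bar>(\<psi> (z l) - \<psi>s l (z l)) - (\<psi> (xbar l k) - \<psi>s l (xbar l k))\<bar> \<le> B l" (is "\<bar>?a\<bar> \<le> _")
      and "\<bar>(\<psi> (z k) - \<psi>s k (z k)) - (\<psi> (xbar l k) - \<psi>s k (xbar l k))\<bar> \<le> B k" (is "\<bar>?c\<bar> \<le> _")
      using osc z by blast+
    then have "(?a - ?c)\<^sup>2 \<le> 2 * ((B l)\<^sup>2 + (B k)\<^sup>2)"
      unfolding distrib_left by (rule square_diff_le_of_abs_le)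
    moreover have "?a - ?c = \<psi> (z l) - \<psi>s l (z l) - (\<psi> (z k) - \<psi>s k (z k))
        - (\<psi>s k (xbar l k) - \<psi>s l (xbar l k))"
      by simp
    ultimately show ?thesis by simp
  qed
  have "residual_sq M \<Omega>s xbar \<psi>s (\<lambda>l. \<psi> (z l) - \<psi>s l (z l))
      \<le> (\<Sum>(l,k)\<in>?G. 2 * ((B l)\<^sup>2 + (B k)\<^sup>2))"
    unfolding residual_sq_def by (rule sum_mono) (use pair_le in auto)
  also have "\<dots> = 2 * (\<Sum>(l,k)\<in>?G. (B l)\<^sup>2 + (B k)\<^sup>2)"
    by (simp add: sum_distrib_left case_prod_beta)
  also have "\<dots> \<le> 4 * real m * (\<Sum>l<M. (B l)\<^sup>2)"
    using sum_glue_pairs_le[of M "\<lambda>l. (B l)\<^sup>2" \<Omega>s m] degree by simp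
  finally show ?thesis .
qed

lemma least_squares_residual_le_oscillation:
  assumes "least_squares_solution M \<Omega>s xbar \<psi>s b"
    and "\<forall>(l,k)\<in>glue_pairs M \<Omega>s. xbar l k \<in> \<Omega>s l \<inter> \<Omega>s k"
    and nonempty: "\<forall>l<M. \<Omega>s l \<noteq> {}"
    and "\<And>l x y. l < M \<Longrightarrow> x \<in> \<Omega>s l \<Longrightarrow> y \<in> \<Omega>s l \<Longrightarrow>
      \<bar>(\<psi> y - \<psi>s l y) - (\<psi> x - \<psi>s l x)\<bar> \<le> B l"
    and "\<forall>l<M. card {k. k < M \<and> k \<noteq> l \<and> \<Omega>s l \<inter> \<Omega>s k \<noteq> {}} \<le> m"
  shows "residual_sq M \<Omega>s xbar \<psi>s b \<le> 4 * real m * (\<Sum>l<M. (B l)\<^sup>2)"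
proof -
  define z where "z l = (SOME x. x \<in> \<Omega>s l)" for l
  have "\<forall>l<M. z l \<in> \<Omega>s l" using nonempty unfolding z_def by (simp add: some_in_eq)
  then have "residual_sq M \<Omega>s xbar \<psi>s (\<lambda>l. \<psi> (z l) - \<psi>s l (z l))
      \<le> 4 * real m * (\<Sum>l<M. (B l)\<^sup>2)"
    using residual_sq_potential_offsets_le assms(2,4,5) by blast
  moreover have "residual_sq M \<Omega>s xbar \<psi>s b \<le> residual_sq M \<Omega>s xbar \<psi>s (\<lambda>l. \<psi> (z l) - \<psi>s l (z l))"
    using assms(1) unfolding least_squares_solution_def by blast
  ultimately show ?thesis by linarith
qed

theorem proposition4p4:
  fixes P :: "pt set" and n :: "pt \<Rightarrow> pt" and \<Omega> :: "pt set"
    and \<tau> CE cl Cd Ccomp :: real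
  assumes "smooth_oriented_surface P n" and "\<Omega> \<subseteq> P" and "openin (top_of_set P) \<Omega>"
    and "bounded \<Omega>" and "\<tau> > 1" and "CE > 0" and "cl > 0" and "Cd > 0" and "Ccomp \<ge> 1"
  shows "\<exists>C>0. \<forall>(M::nat) (m::nat) (\<Omega>s::nat \<Rightarrow> pt set) (X::pt set) (h::nat \<Rightarrow> real)
      (\<psi>::pt \<Rightarrow> real) (\<psi>s::nat \<Rightarrow> pt \<Rightarrow> real) (u::pt \<Rightarrow> pt) (s::nat \<Rightarrow> pt \<Rightarrow> pt)
      (nu::nat \<Rightarrow> real) (xbar::nat \<Rightarrow> nat \<Rightarrow> pt) (b::nat \<Rightarrow> real).
      \<Omega> = (\<Union>l<M. \<Omega>s l) \<longrightarrow>
      (\<forall>l<M. openin (top_of_set P) (\<Omega>s l) \<and> \<Omega>s l \<noteq> {}) \<longrightarrow>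
      (\<forall>l<M. card {k. k < M \<and> k \<noteq> l \<and> \<Omega>s l \<inter> \<Omega>s k \<noteq> {}} \<le> m) \<longrightarrow>
      finite X \<longrightarrow>
      (\<forall>l<M. 0 < h l \<and> h l = mesh_norm X (\<Omega>s l)) \<longrightarrow>
      (\<forall>l<M. ereal (cl * h l) \<le> intrinsic_diam (\<Omega>s l) \<and> intrinsic_diam (\<Omega>s l) \<le> ereal (Cd * h l)) \<longrightarrow>
      (\<forall>l<M. \<forall>k<M. \<Omega>s l \<inter> \<Omega>s k \<noteq> {} \<longrightarrow> h k \<le> Ccomp * h l) \<longrightarrow>
      surface_curl_of \<Omega> n \<psi> u \<longrightarrow>
      (\<forall>l<M. surface_curl_of (\<Omega>s l) n (\<psi>s l) (s l) \<and> (\<forall>x\<in>X \<inter> \<Omega>s l. s l x = u x)) \<longrightarrow>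
      (\<forall>l<M. 0 \<le> nu l \<and> (\<forall>x\<in>\<Omega>s l. norm (u x - s l x) \<le> Err CE \<tau> (h l) * nu l)) \<longrightarrow>
      (\<forall>(l,k)\<in>glue_pairs M \<Omega>s. xbar l k \<in> \<Omega>s l \<inter> \<Omega>s k) \<longrightarrow>
      least_squares_solution M \<Omega>s xbar \<psi>s b \<longrightarrow>
      residual_sq M \<Omega>s xbar \<psi>s b
        \<le> real m * C * (\<Sum>l<M. (h l)\<^sup>2 * (Err CE \<tau> (h l))\<^sup>2 * (nu l)\<^sup>2)"
proof (intro exI[of _ "4 * Cd\<^sup>2"] conjI allI impI)
  show "0 < 4 * Cd\<^sup>2" using \<open>Cd > 0\<close> by simp
  fix M m :: nat and \<Omega>s :: "nat \<Rightarrow> pt set" and X :: "pt set" and h :: "nat \<Rightarrow> real"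
    and \<psi> :: "pt \<Rightarrow> real" and \<psi>s :: "nat \<Rightarrow> pt \<Rightarrow> real" and u :: "pt \<Rightarrow> pt" and s :: "nat \<Rightarrow> pt \<Rightarrow> pt"
    and nu :: "nat \<Rightarrow> real" and xbar :: "nat \<Rightarrow> nat \<Rightarrow> pt" and b :: "nat \<Rightarrow> real"
  assume cover: "\<Omega> = (\<Union>l<M. \<Omega>s l)"
    and patches: "\<forall>l<M. openin (top_of_set P) (\<Omega>s l) \<and> \<Omega>s l \<noteq> {}"
    and degree: "\<forall>l<M. card {k. k < M \<and> k \<noteq> l \<and> \<Omega>s l \<inter> \<Omega>s k \<noteq> {}} \<le> m"
    and "finite X" and "\<forall>l<M. 0 < h l \<and> h l = mesh_norm X (\<Omega>s l)"
    and diam: "\<forall>l<M. ereal (cl * h l) \<le> intrinsic_diam (\<Omega>s l) \<and> intrinsic_diam (\<Omega>s l) \<le> ereal (Cd * h l)"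
    and "\<forall>l<M. \<forall>k<M. \<Omega>s l \<inter> \<Omega>s k \<noteq> {} \<longrightarrow> h k \<le> Ccomp * h l"
    and curl_u: "surface_curl_of \<Omega> n \<psi> u"
    and curl_s: "\<forall>l<M. surface_curl_of (\<Omega>s l) n (\<psi>s l) (s l) \<and> (\<forall>x\<in>X \<inter> \<Omega>s l. s l x = u x)"
    and local_err: "\<forall>l<M. 0 \<le> nu l \<and> (\<forall>x\<in>\<Omega>s l. norm (u x - s l x) \<le> Err CE \<tau> (h l) * nu l)"
    and xbar: "\<forall>(l,k)\<in>glue_pairs M \<Omega>s. xbar l k \<in> \<Omega>s l \<inter> \<Omega>s k"
    and lsq: "least_squares_solution M \<Omega>s xbar \<psi>s b"
  have "\<forall>x\<in>P. norm (n x) = 1"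
    using \<open>smooth_oriented_surface P n\<close> unfolding smooth_oriented_surface_def by blast
  then have unit: "norm (n x) = 1" if "x \<in> \<Omega>" for x
    using \<open>\<Omega> \<subseteq> P\<close> that by blast
  have osc: "\<bar>(\<psi> y - \<psi>s l y) - (\<psi> x - \<psi>s l x)\<bar> \<le> Err CE \<tau> (h l) * nu l * (Cd * h l)"
    if l: "l < M" and xy: "x \<in> \<Omega>s l" "y \<in> \<Omega>s l" for l x y
  proof (rule surface_curl_potential_oscillation[where S = "\<Omega>s l" and U = u and V = "s l"])
    show "surface_curl_of (\<Omega>s l) n \<psi> u"
      using surface_curl_of_subset[OF curl_u] cover l by blast
    show "surface_curl_of (\<Omega>s l) n (\<psi>s l) (s l)" using curl_s l by blast
    show "norm (n z) = 1" if "z \<in> \<Omega>s l" for z using unit cover l that by blast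
    show "norm (u z - s l z) \<le> Err CE \<tau> (h l) * nu l" if "z \<in> \<Omega>s l" for z
      using local_err l that by blast
    show "intrinsic_diam (\<Omega>s l) \<le> ereal (Cd * h l)" using diam l by blast
  qed (use xy in simp_all)
  have "residual_sq M \<Omega>s xbar \<psi>s b \<le> 4 * real m * (\<Sum>l<M. (Err CE \<tau> (h l) * nu l * (Cd * h l))\<^sup>2)"
    using least_squares_residual_le_oscillation[OF lsq xbar _ osc degree] patches by blast
  also have "(\<Sum>l<M. (Err CE \<tau> (h l) * nu l * (Cd * h l))\<^sup>2)
      = Cd\<^sup>2 * (\<Sum>l<M. (h l)\<^sup>2 * (Err CE \<tau> (h l))\<^sup>2 * (nu l)\<^sup>2)"
    by (simp add: sum_distrib_left power_mult_distrib mult_ac)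
  finally show "residual_sq M \<Omega>s xbar \<psi>s b
        \<le> real m * (4 * Cd\<^sup>2) * (\<Sum>l<M. (h l)\<^sup>2 * (Err CE \<tau> (h l))\<^sup>2 * (nu l)\<^sup>2)"
    by (simp add: mult_ac)
qed

end
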